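(* As $n\to\infty$, the sequence $V_n(\phi_0,\phi_1)$ converges to $V(\phi_0,\phi_1)$ uniformly in $(\phi_0,\phi_1)\in\mathbb R_+^2$. In fact, for every $n\in\mathbb N$ and $(\phi_0,\phi_1)\in\mathbb R_+^2$, $$\frac{\sqrt2}{c}\cdot\Big(\frac{\mu}{\lambda+\mu}\Big)^n\ge V_n(\phi_0,\phi_1)-V(\phi_0,\phi_1)\ge0.$$
   Context: Fix constants $\lambda>0$, $\mu>1$, $c>0$, $m\in(-1,1)$; $\mathbb R_+=[0,\infty)$, $\mathbb N=\{1,2,\dots\}$. On a probability space $(\Omega,\mathcal H,\mathbb P_0)$ let $N$ be a homogeneous Poisson process with rate $\mu$ and jump times $0=\sigma_0<\sigma_1<\sigma_2<\cdots$; $\mathbb F$ is the right-continuous enlargement with $\mathbb P_0$-null sets of its natural filtration, and $\mathcal S$ is the collection of all $\mathbb F$-stopping times. For $\phi_0,\phi_1\in\mathbb R$ let $x(t,\phi_0)$, $y(t,\phi_1)$, $t\in\mathbb R$, be the solutions of $$\frac{d}{dt}x(t,\phi_0)=(\lambda+1)x(t,\phi_0)+\frac{\lambda(1-m)}{\sqrt2},\ x(0,\phi_0)=\phi_0;\qquad \frac{d}{dt}y(t,\phi_1)=(\lambda-1)y(t,\phi_1)+\frac{\lambda(1+m)}{\sqrt2},\ y(0,\phi_1)=\phi_1,$$ and let $S(\phi_0,\phi_1)=\big((1-\frac1\mu)\phi_0,(1+\frac1\mu)\phi_1\big)$. The process $\widetilde\Phi=(\widetilde\Phi^{(0)},\widetilde\Phi^{(1)})$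 in $\mathbb R_+^2$ started at $(\phi_0,\phi_1)$ satisfies $\widetilde\Phi_0=(\phi_0,\phi_1)$, $\widetilde\Phi_t=\big(x(t-\sigma_n,\widetilde\Phi^{(0)}_{\sigma_n}),y(t-\sigma_n,\widetilde\Phi^{(1)}_{\sigma_n})\big)$ for $\sigma_n\le t<\sigma_{n+1}$, $n\ge0$, and $\widetilde\Phi_{\sigma_n}=S(\widetilde\Phi_{\sigma_n-})$ for $n\ge1$. $\mathbb E_0^{\phi_0,\phi_1}$ is the $\mathbb P_0$-expectation when $\widetilde\Phi_0=(\phi_0,\phi_1)$. With $g(\phi_0,\phi_1)=\phi_0+\phi_1-\frac{\lambda}{c}\sqrt2$, define for $(\phi_0,\phi_1)\in\mathbb R_+^2$ $$V(\phi_0,\phi_1)=\inf_{\tau\in\mathcal S}\mathbb E_0^{\phi_0,\phi_1}\Big[\int_0^\tau e^{-\lambda t}g(\widetilde\Phi_t)\,dt\Big],\qquad V_n(\phi_0,\phi_1)=\inf_{\tau\in\mathcal S}\mathbb E_0^{\phi_0,\phi_1}\Big[\int_0^{\tau\wedge\sigma_n} e^{-\lambda t}g(\widetilde\Phi_t)\,dt\Big],\ n\in\mathbb N.$$ *)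

theory Defs
  imports "HOL-Probability.Probability"
begin

section \<open>Poisson process, jump times and the augmented filtration\<close>

text \<open>
  A path is only meaningful on \<open>[0, \<infinity>)\<close>. Taking every value in \<open>\<nat>\<close> amounts, for a
  nondecreasing path started at \<open>0\<close>, to having unit jumps and infinitely many of them; with
  right-continuity this gives jump times \<open>0 = \<sigma>\<^sub>0 < \<sigma>\<^sub>1 < \<sigma>\<^sub>2 < \<dots>\<close> tending to infinity, on all
  of \<open>\<Omega>\<close>.
\<close>

definition counting_path :: "(real \<Rightarrow> nat) \<Rightarrow> bool" where
  "counting_path f \<longleftrightarrow>
     f 0 = 0 \<and> mono_on {0..} f \<and> (\<forall>t\<ge>0. continuous (at_right t) f) \<and> f ` {0..} = UNIV"

text \<open>
  Truncated subtraction of naturals is harmless in the increments, because the paths are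
  nondecreasing on \<open>[0, \<infinity>)\<close>.
\<close>

locale poisson_process = prob_space M
  for M :: "'a measure" and rate :: real and N :: "real \<Rightarrow> 'a \<Rightarrow> nat" +
  assumes rate_pos: "0 < rate"
    and measurable_N: "\<And>t. 0 \<le> t \<Longrightarrow> N t \<in> measurable M (count_space UNIV)"
    and paths: "\<And>\<omega>. \<omega> \<in> space M \<Longrightarrow> counting_path (\<lambda>t. N t \<omega>)"
    and indep_increments: "\<And>(t :: nat \<Rightarrow> real) k. 0 \<le> t 0 \<Longrightarrow> (\<forall>i<k. t i \<le> t (Suc i)) \<Longrightarrow>
      indep_vars (\<lambda>_. count_space UNIV) (\<lambda>i \<omega>. N (t (Suc i)) \<omega> - N (t i) \<omega>) {..<k}"
    and poisson_increments: "\<And>s t. 0 \<le> s \<Longrightarrow> s < t \<Longrightarrow>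
      distr M (count_space UNIV) (\<lambda>\<omega>. N t \<omega> - N s \<omega>) = measure_pmf (poisson_pmf (rate * (t - s)))"

definition jump_time :: "(real \<Rightarrow> 'a \<Rightarrow> nat) \<Rightarrow> nat \<Rightarrow> 'a \<Rightarrow> real" where
  "jump_time N n \<omega> = Inf {t. 0 \<le> t \<and> n \<le> N t \<omega>}"

text \<open>
  Time is indexed by \<open>[0, \<infinity>]\<close>, since stopping times may be infinite. The \<open>\<sigma>\<close>-algebra at
  \<open>\<infinity>\<close> imposes no condition on stopping times, as \<open>{\<tau> \<le> \<infinity>} = \<Omega>\<close>.
\<close>

definition null_augmented_filtration ::
    "'a measure \<Rightarrow> (real \<Rightarrow> 'a \<Rightarrow> nat) \<Rightarrow> ennreal \<Rightarrow> 'a measure" where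
  "null_augmented_filtration M N t =
     sigma (space M)
       ({N s -` A \<inter> space M | s A. 0 \<le> s \<and> ennreal s \<le> t} \<union> null_sets M)"

text \<open>The index \<open>\<infinity>\<close> is inserted only to avoid an empty intersection at \<open>t = \<infinity>\<close>.\<close>

definition usual_filtration ::
    "'a measure \<Rightarrow> (real \<Rightarrow> 'a \<Rightarrow> nat) \<Rightarrow> ennreal \<Rightarrow> 'a measure" where
  "usual_filtration M N t =
     sigma (space M) (\<Inter>u\<in>insert \<infinity> {t<..}. sets (null_augmented_filtration M N u))"

definition stopping_times :: "'a measure \<Rightarrow> (real \<Rightarrow> 'a \<Rightarrow> nat) \<Rightarrow> ('a \<Rightarrow> ennreal) set" where
  "stopping_times M N = {\<tau>. stopping_time (usual_filtration M N) \<tau>}"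

section \<open>The process \<open>\<Phi>\<close>\<close>

definition solves_affine_ode :: "real \<Rightarrow> real \<Rightarrow> real \<Rightarrow> (real \<Rightarrow> real) \<Rightarrow> bool" where
  "solves_affine_ode a b u0 u \<longleftrightarrow>
     u 0 = u0 \<and> (\<forall>t. (u has_real_derivative (a * u t + b)) (at t))"

definition jump_map :: "real \<Rightarrow> real \<times> real \<Rightarrow> real \<times> real" where
  "jump_map \<mu> z = ((1 - 1 / \<mu>) * fst z, (1 + 1 / \<mu>) * snd z)"

text \<open>
  \<open>x t \<phi>\<close> and \<open>y t \<phi>\<close> are the flows. The left limit \<open>Lim (at_left \<sigma>\<^sub>n)\<close> exists by the flow
  equation on \<open>[\<sigma>\<^sub>n\<^sub>-\<^sub>1, \<sigma>\<^sub>n)\<close>, so the equations determine the process at all times \<open>t \<ge> 0\<close>.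
\<close>

definition is_Phi_process ::
    "'a measure \<Rightarrow> real \<Rightarrow> (real \<Rightarrow> 'a \<Rightarrow> nat) \<Rightarrow> (real \<Rightarrow> real \<Rightarrow> real) \<Rightarrow> (real \<Rightarrow> real \<Rightarrow> real) \<Rightarrow>
     real \<times> real \<Rightarrow> (real \<Rightarrow> 'a \<Rightarrow> real \<times> real) \<Rightarrow> bool" where
  "is_Phi_process M \<mu> N x y \<phi> Z \<longleftrightarrow> (\<forall>\<omega>\<in>space M.
     Z 0 \<omega> = \<phi> \<and>
     (\<forall>n t. jump_time N n \<omega> \<le> t \<and> t < jump_time N (Suc n) \<omega> \<longrightarrow>
        Z t \<omega> = (x (t - jump_time N n \<omega>) (fst (Z (jump_time N n \<omega>) \<omega>)),
                 y (t - jump_time N n \<omega>) (snd (Z (jump_time N n \<omega>) \<omega>)))) \<and>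
     (\<forall>n\<ge>1. Z (jump_time N n \<omega>) \<omega> =
        jump_map \<mu> (Lim (at_left (jump_time N n \<omega>)) (\<lambda>t. Z t \<omega>))))"

section \<open>Value functions\<close>

text \<open>
  The positive part of the discounted cost need not be integrable (neither in time nor over
  \<open>\<Omega>\<close>), in which case the Bochner integral would return \<open>0\<close>; hence the extended-real integral.
  Below, the negative parts are always bounded by \<open>sqrt 2 / c\<close>, so \<open>\<infinity> - \<infinity>\<close> never occurs.
\<close>

definition ext_integral :: "'b measure \<Rightarrow> ('b \<Rightarrow> ereal) \<Rightarrow> ereal" where
  "ext_integral M f =
     enn2ereal (\<integral>\<^sup>+ z. e2ennreal (f z) \<partial>M) - enn2ereal (\<integral>\<^sup>+ z. e2ennreal (- f z) \<partial>M)"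

definition running_cost :: "real \<Rightarrow> real \<Rightarrow> real \<times> real \<Rightarrow> real" where
  "running_cost lam c z = fst z + snd z - lam / c * sqrt 2"

definition expected_cost ::
    "'a measure \<Rightarrow> real \<Rightarrow> real \<Rightarrow> (real \<Rightarrow> 'a \<Rightarrow> real \<times> real) \<Rightarrow> ('a \<Rightarrow> ennreal) \<Rightarrow> ereal" where
  "expected_cost M lam c Z \<tau> =
     ext_integral M (\<lambda>\<omega>. ext_integral lborel (\<lambda>t.
       ereal (indicator {t. 0 \<le> t \<and> ennreal t \<le> \<tau> \<omega>} t
              * (exp (- lam * t) * running_cost lam c (Z t \<omega>)))))"

definition V ::
    "'a measure \<Rightarrow> real \<Rightarrow> real \<Rightarrow> (real \<Rightarrow> 'a \<Rightarrow> nat) \<Rightarrow>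
     (real \<times> real \<Rightarrow> real \<Rightarrow> 'a \<Rightarrow> real \<times> real) \<Rightarrow> real \<times> real \<Rightarrow> ereal" where
  "V M lam c N \<Phi> \<phi> = (INF \<tau>\<in>stopping_times M N. expected_cost M lam c (\<Phi> \<phi>) \<tau>)"

definition V_trunc ::
    "'a measure \<Rightarrow> real \<Rightarrow> real \<Rightarrow> (real \<Rightarrow> 'a \<Rightarrow> nat) \<Rightarrow>
     (real \<times> real \<Rightarrow> real \<Rightarrow> 'a \<Rightarrow> real \<times> real) \<Rightarrow> nat \<Rightarrow> real \<times> real \<Rightarrow> ereal" where
  "V_trunc M lam c N \<Phi> n \<phi> =
     (INF \<tau>\<in>stopping_times M N.
        expected_cost M lam c (\<Phi> \<phi>) (\<lambda>\<omega>. min (\<tau> \<omega>) (ennreal (jump_time N n \<omega>))))"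

text \<open>
  In \<open>ereal\<close> any difference involving an infinite term is infinite, so an inequality
  \<open>0 \<le> V_trunc \<dots> - V \<dots> \<le> r\<close> with real \<open>r\<close> includes finiteness of both terms.
\<close>

lemma ereal_diff_bounded_imp_finite:
  fixes a b :: ereal
  assumes "0 \<le> a - b" "a - b \<le> ereal r"
  shows "\<bar>a\<bar> \<noteq> \<infinity>" "\<bar>b\<bar> \<noteq> \<infinity>"
  using assms by (cases a; cases b; simp)+

end

theory Submission
  imports Defs
begin

text \<open>
  The process \<open>\<Phi>\<close> stays in the nonnegative quadrant, so the discounted running cost is bounded
  below by \<open>- (lam * sqrt 2 / c) * exp (- lam * t)\<close>. Stopping at \<open>min \<tau> \<sigma>\<^sub>n\<close> instead of \<open>\<tau>\<close> therefore
  increases the pathwise cost by at most \<open>sqrt 2 / c * exp (- lam * \<sigma>\<^sub>n)\<close>, whose expectation is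
  \<open>sqrt 2 / c * (\<mu> / (lam + \<mu>)) ^ n\<close> because \<open>\<sigma>\<^sub>n\<close> is Erlang distributed. Conversely,
  \<open>min \<tau> \<sigma>\<^sub>n\<close> is itself a stopping time, so truncation cannot decrease the infimum.
\<close>

section \<open>The extended integral\<close>

text \<open>Splitting \<open>g\<close> and \<open>f\<close> into positive and negative parts and
  moving the negative parts across the inequality leaves only sums in \<open>ennreal\<close>.
  Nothing of the form infinity minus infinity arises, and both sides can be integrated.\<close>

lemma e2ennreal_mono_add:
  assumes "g \<le> f + enn2ereal d"
  shows "e2ennreal g + e2ennreal (- f) \<le> e2ennreal f + (e2ennreal (- g) + d)"
proof (cases d)
  case (real r)
  have e: "enn2ereal d = ereal r"
    using real by simp
  show ?thesis
  proof (cases f; cases g)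
    fix p q assume pq: "f = ereal p" "g = ereal q"
    have "q \<le> p + r" using assms pq e by simp
    then have "ennreal (max 0 q + max 0 (-p)) \<le> ennreal (max 0 p + (max 0 (-q) + r))"
      by (intro ennreal_leI) auto
    moreover have "ennreal (max 0 s) = ennreal s" for s
      by (cases "0 \<le> s") (auto simp: ennreal_neg max_def)
    ultimately show ?thesis
      using pq real by simp
  qed (use assms e in auto)
qed (simp add: top_unique)

text \<open>Integrating the subtraction-free inequality and cancelling the finite integrals of the
  negative parts gives a comparison that tolerates infinite positive parts. It serves once for the
  time integral and once for the expectation.\<close>

lemma ext_integral_mono_add:
  assumes [measurable]: "f \<in> borel_measurable M" "g \<in> borel_measurable M" "d \<in> borel_measurable M"
    and f: "(\<integral>\<^sup>+z. e2ennreal (- f z) \<partial>M) < \<infinity>" and g: "(\<integral>\<^sup>+z. e2ennreal (- g z) \<partial>M) < \<infinity>"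
    and d: "(\<integral>\<^sup>+z. d z \<partial>M) < \<infinity>"
    and le: "\<And>z. z \<in> space M \<Longrightarrow> g z \<le> f z + enn2ereal (d z)"
  shows "ext_integral M g \<le> ext_integral M f + enn2ereal (\<integral>\<^sup>+z. d z \<partial>M)"
proof -
  have "(\<integral>\<^sup>+z. e2ennreal (g z) + e2ennreal (- f z) \<partial>M)
      \<le> (\<integral>\<^sup>+z. e2ennreal (f z) + (e2ennreal (- g z) + d z) \<partial>M)"
    by (intro nn_integral_mono e2ennreal_mono_add le)
  then have le': "(\<integral>\<^sup>+z. e2ennreal (g z) \<partial>M) + (\<integral>\<^sup>+z. e2ennreal (- f z) \<partial>M)
      \<le> (\<integral>\<^sup>+z. e2ennreal (f z) \<partial>M) + ((\<integral>\<^sup>+z. e2ennreal (- g z) \<partial>M) + (\<integral>\<^sup>+z. d z \<partial>M))"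
    by (simp add: nn_integral_add)
  \<comment> \<open>If \<open>b\<close> is infinite, so is the right-hand side; otherwise
    \<open>a\<close> is finite too and only real arithmetic remains.\<close>
  have *: "enn2ereal a - enn2ereal a' \<le> enn2ereal b - enn2ereal b' + enn2ereal e"
    if "a + b' \<le> b + (a' + e)" "a' < \<infinity>" "b' < \<infinity>" "e < \<infinity>" for a b a' b' e :: ennreal
  proof (cases b)
    case (real r)
    with that have "a < \<infinity>"
      by (metis ennreal_add_eq_top ennreal_less_top infinity_ennreal_def order_le_less_trans
          top.not_eq_extremum)
    with that real show ?thesis
      by (cases a; cases a'; cases b'; cases e)
         (auto simp flip: ennreal_plus)
  qed (use that in \<open>cases a'; cases b'; cases e; simp\<close>)
  show ?thesis
    unfolding ext_integral_def by (rule *[OF le' g f d])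
qed

lemma nn_integral_exp_atLeast:
  assumes "0 < l"
  shows "(\<integral>\<^sup>+t. ennreal (l * exp (- l * t)) * indicator {a..} t \<partial>lborel) = ennreal (exp (- l * a))"
proof -
  have "((\<lambda>t. - exp (- l * t)) \<longlongrightarrow> 0) at_top"
    using assms by real_asymp
  then show ?thesis
    using assms
    by (subst nn_integral_FTC_atLeast[where F="\<lambda>t. - exp (- l * t)" and T=0])
       (auto intro!: derivative_eq_intros)
qed

section \<open>The affine flows\<close>

text \<open>The difference of two solutions is homogeneous, so the integrating factor makes it
  constant. The affine dependence on \<open>u0\<close> later reduces joint measurability of the flow
  to that of the single path \<open>v\<close>.\<close>

lemma affine_ode_eq:
  assumes u: "solves_affine_ode a b u0 u" and v: "solves_affine_ode a b 0 v"
  shows "u t = exp (a * t) * u0 + v t"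
proof -
  let ?w = "\<lambda>t. (u t - v t) * exp (- a * t)"
  have "(?w has_real_derivative 0) (at s)" for s
    using u v unfolding solves_affine_ode_def
    by (auto intro!: derivative_eq_intros simp: algebra_simps)
  then have "?w t = ?w 0"
    by (intro DERIV_isconst_all) auto
  also have "\<dots> = u0"
    using u v by (simp add: solves_affine_ode_def)
  finally have "exp (a * t) * u0 = (u t - v t) * (exp (- a * t) * exp (a * t))"
    by simp
  then show ?thesis
    by (simp flip: exp_add)
qed

text \<open>After multiplication by \<open>exp (- a * t)\<close> the derivative is
  \<open>b * exp (- a * t)\<close>, nonnegative whatever the sign of \<open>a\<close>; this matters
  because \<open>lam - 1\<close> may be negative.\<close>

lemma affine_ode_nonneg:
  assumes u: "solves_affine_ode a b u0 u" and "0 \<le> b" "0 \<le> u0" "0 \<le> t"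
  shows "0 \<le> u t"
proof -
  let ?w = "\<lambda>t. u t * exp (- a * t)"
  have w: "(?w has_real_derivative b * exp (- a * s)) (at s)" for s
    using u unfolding solves_affine_ode_def
    by (auto intro!: derivative_eq_intros simp: algebra_simps)
  have "?w 0 \<le> ?w t"
  proof (rule DERIV_nonneg_imp_nondecreasing[OF \<open>0 \<le> t\<close>])
    fix s
    show "\<exists>D. (?w has_real_derivative D) (at s) \<and> 0 \<le> D"
      using w[of s] \<open>0 \<le> b\<close> by (intro exI[of _ "b * exp (- a * s)"]) simp
  qed
  moreover have "u 0 = u0"
    using u by (simp add: solves_affine_ode_def)
  ultimately have "0 \<le> u t * exp (- a * t)"
    using assms by simp
  then show ?thesis
    by (simp add: zero_le_mult_iff)
qed

lemma affine_ode_continuous: "solves_affine_ode a b u0 u \<Longrightarrow> continuous_on S u"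
  unfolding solves_affine_ode_def
  by (meson DERIV_isCont continuous_at_imp_continuous_on)

section \<open>Jump times\<close>

text \<open>Right-continuity makes the infimum attained: a path below \<open>n\<close> at
  \<open>t\<close> stays below \<open>n\<close> on some interval to the right of \<open>t\<close>,
  so the jump time exceeds \<open>t\<close>. Measurability, law and stopping property of the jump
  times all come from this equivalence.\<close>

lemma counting_path_jump_time_le_iff:
  assumes N: "counting_path (\<lambda>t. N t \<omega>)" and t: "0 \<le> t"
  shows "jump_time N n \<omega> \<le> t \<longleftrightarrow> n \<le> N t \<omega>"
proof
  let ?S = "{t. 0 \<le> t \<and> n \<le> N t \<omega>}"
  have mono: "N r \<omega> \<le> N s \<omega>" if "0 \<le> r" "r \<le> s" for r s
    using N that unfolding counting_path_def mono_on_def by auto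
  have "n \<in> (\<lambda>t. N t \<omega>) ` {0..}"
    using N unfolding counting_path_def by blast
  then have ne: "?S \<noteq> {}" by auto
  show "n \<le> N t \<omega>" if le: "jump_time N n \<omega> \<le> t"
  proof (rule ccontr)
    assume "\<not> n \<le> N t \<omega>"
    then have less: "N t \<omega> < n" by simp
    have "((\<lambda>t. N t \<omega>) \<longlongrightarrow> N t \<omega>) (at_right t)"
      using N t unfolding counting_path_def continuous_within by auto
    then have "\<forall>\<^sub>F s in at_right t. N s \<omega> < n"
      using less by (rule order_tendstoD)
    then obtain b where b: "t < b" "\<And>s. t < s \<Longrightarrow> s < b \<Longrightarrow> N s \<omega> < n"
      unfolding eventually_at_right_field by blast
    have "b \<le> s" if "s \<in> ?S" for s
    proof (rule ccontr)
      assume "\<not> b \<le> s"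
      then show False
        using that b(2)[of s] mono[of s t] less by (cases "t < s") auto
    qed
    then have "b \<le> jump_time N n \<omega>"
      unfolding jump_time_def using ne by (intro cInf_greatest) auto
    with le b show False by simp
  qed
  show "jump_time N n \<omega> \<le> t" if "n \<le> N t \<omega>"
    unfolding jump_time_def using t that by (intro cInf_lower bdd_belowI[of _ 0]) auto
qed

context poisson_process
begin

abbreviation "\<sigma> \<equiv> jump_time N"

lemma jump_time_le_iff: "\<omega> \<in> space M \<Longrightarrow> 0 \<le> t \<Longrightarrow> \<sigma> n \<omega> \<le> t \<longleftrightarrow> n \<le> N t \<omega>"
  by (rule counting_path_jump_time_le_iff[OF paths])

lemma jump_time_nonneg:
  assumes "\<omega> \<in> space M"
  shows "0 \<le> \<sigma> n \<omega>"
proof -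
  have "n \<in> (\<lambda>t. N t \<omega>) ` {0..}"
    using paths[OF assms] unfolding counting_path_def by blast
  then show ?thesis
    unfolding jump_time_def by (intro cInf_greatest) auto
qed

lemma jump_time_0: "\<omega> \<in> space M \<Longrightarrow> \<sigma> 0 \<omega> = 0"
  using jump_time_le_iff[of \<omega> 0 0] jump_time_nonneg[of \<omega> 0] by simp

text \<open>Surjectivity provides a time at which the path equals exactly \<open>n\<close>; this
  time separates the two jump times.\<close>

lemma jump_time_less_Suc:
  assumes "\<omega> \<in> space M"
  shows "\<sigma> n \<omega> < \<sigma> (Suc n) \<omega>"
proof -
  have "n \<in> (\<lambda>t. N t \<omega>) ` {0..}"
    using paths[OF assms] unfolding counting_path_def by blast
  then obtain t where t: "0 \<le> t" "N t \<omega> = n" by auto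
  then have "\<sigma> n \<omega> \<le> t" "\<not> \<sigma> (Suc n) \<omega> \<le> t"
    using jump_time_le_iff[OF assms] by auto
  then show ?thesis by simp
qed

lemma jump_time_bracket:
  assumes "\<omega> \<in> space M" "0 \<le> t"
  shows "\<sigma> (N t \<omega>) \<omega> \<le> t" "t < \<sigma> (Suc (N t \<omega>)) \<omega>"
  using jump_time_le_iff[OF assms] by (auto simp flip: not_le)

lemma measurable_jump_time [measurable]: "\<sigma> n \<in> borel_measurable M"
proof (rule borel_measurableI_le)
  fix t
  show "{\<omega> \<in> space M. \<sigma> n \<omega> \<le> t} \<in> sets M"
  proof (cases "0 \<le> t")
    case True
    note [measurable] = measurable_N[OF True]
    have "{\<omega> \<in> space M. \<sigma> n \<omega> \<le> t} = {\<omega> \<in> space M. n \<le> N t \<omega>}"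
      using True jump_time_le_iff by blast
    then show ?thesis by simp
  next
    case False
    have "\<not> \<sigma> n \<omega> \<le> t" if "\<omega> \<in> space M" for \<omega>
      using jump_time_nonneg[OF that, of n] False by simp
    then have "{\<omega> \<in> space M. \<sigma> n \<omega> \<le> t} = {}"
      by auto
    then show ?thesis by (simp only: sets.empty_sets)
  qed
qed

text \<open>The target is countable, so level sets suffice, and each is the region between two
  consecutive jump times. \<open>max 0\<close> appears because paths are constrained only at
  nonnegative times.\<close>

lemma measurable_N_pair:
  "(\<lambda>p. N (max 0 (snd p)) (fst p)) \<in> measurable (M \<Otimes>\<^sub>M lborel) (count_space UNIV)"
proof (subst measurable_count_space_eq2_countable, intro conjI ballI)
  fix k
  have "(\<lambda>p. N (max 0 (snd p)) (fst p)) -` {k} \<inter> space (M \<Otimes>\<^sub>M lborel) =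
     {p \<in> space (M \<Otimes>\<^sub>M lborel). \<sigma> k (fst p) \<le> max 0 (snd p) \<and> \<not> \<sigma> (Suc k) (fst p) \<le> max 0 (snd p)}"
    by (auto simp: space_pair_measure jump_time_le_iff)
  also have "\<dots> \<in> sets (M \<Otimes>\<^sub>M lborel)"
    by measurable
  finally show "(\<lambda>p. N (max 0 (snd p)) (fst p)) -` {k} \<inter> space (M \<Otimes>\<^sub>M lborel) \<in> sets (M \<Otimes>\<^sub>M lborel)" .
qed auto

section \<open>Erlang law and Laplace transform of the jump times\<close>

text \<open>The jump \<open>Suc k\<close> comes after \<open>t\<close> exactly when
  \<open>N t \<le> k\<close>, and the Poisson probability of that event is one minus the Erlang
  distribution function. Index \<open>k\<close> of \<open>erlang_CDF\<close> belongs to jump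
  \<open>Suc k\<close>.\<close>

lemma emeasure_jump_time_le:
  assumes "0 \<le> t"
  shows "emeasure M {\<omega> \<in> space M. \<sigma> (Suc k) \<omega> \<le> t} = erlang_CDF k rate t"
\<comment> \<open>The law of increments is given for nondegenerate intervals, so
  \<open>t = 0\<close> is separate; both sides vanish there.\<close>
proof (cases "t = 0")
  case True
  have "{\<omega> \<in> space M. \<sigma> (Suc k) \<omega> \<le> t} = {}"
  proof -
    have "\<not> \<sigma> (Suc k) \<omega> \<le> 0" if "\<omega> \<in> space M" for \<omega>
      using jump_time_less_Suc[OF that, of k] jump_time_nonneg[OF that, of k] by simp
    then show ?thesis using True by auto
  qed
  moreover have "(\<Sum>n\<le>k. (0 ^ n :: real) / fact n) = 1"
    by (induction k) auto
  then have "erlang_CDF k rate t = 0"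
    using True by (simp add: erlang_CDF_def)
  ultimately show ?thesis
    by (simp only: emeasure_empty ennreal_0)
next
  case False
  with assms have t: "0 < t" by simp
  note [measurable] = measurable_N[of 0] measurable_N[OF assms]
  have pos: "0 \<le> rate * t" "0 \<le> rate * (t - 0)" using rate_pos t by simp_all
  let ?A = "{\<omega> \<in> space M. N t \<omega> \<le> k}"
  have N0: "N 0 \<omega> = 0" if "\<omega> \<in> space M" for \<omega>
    using paths[OF that] by (simp add: counting_path_def)
  have "emeasure M ?A = emeasure M ((\<lambda>\<omega>. N t \<omega> - N 0 \<omega>) -` {..k} \<inter> space M)"
    using N0 by (intro arg_cong[where f="emeasure M"]) auto
  also have "\<dots> = emeasure (distr M (count_space UNIV) (\<lambda>\<omega>. N t \<omega> - N 0 \<omega>)) {..k}"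
    by (subst emeasure_distr) auto
  also have "\<dots> = emeasure (measure_pmf (poisson_pmf (rate * t))) {..k}"
    using poisson_increments[of 0 t] t by simp
  also have "\<dots> = ennreal (\<Sum>n\<le>k. (rate * t) ^ n * exp (- rate * t) / fact n)"
    using pos rate_pos t
    by (simp add: emeasure_measure_pmf_finite pmf_poisson[OF mult_pos_pos])
  finally have A: "emeasure M ?A = ennreal (\<Sum>n\<le>k. (rate * t) ^ n * exp (- rate * t) / fact n)" .
  have "{\<omega> \<in> space M. \<sigma> (Suc k) \<omega> \<le> t} = space M - ?A"
    using jump_time_le_iff assms by auto
  also have "emeasure M (space M - ?A) = 1 - emeasure M ?A"
    by (subst emeasure_compl) (auto simp: emeasure_space_1)
  also have "\<dots> = ennreal (1 - (\<Sum>n\<le>k. (rate * t) ^ n * exp (- rate * t) / fact n))"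
    unfolding A using pos by (subst ennreal_1[symmetric], subst ennreal_minus) (auto intro!: sum_nonneg)
  also have "\<dots> = erlang_CDF k rate t"
    using t by (simp add: erlang_CDF_def)
  finally show ?thesis .
qed

text \<open>The factor \<open>exp (- l * t)\<close> turns the Erlang density of rate
  \<open>rate\<close> into a multiple of the one of rate \<open>l + rate\<close>, and the latter has
  mass 1. The degenerate time \<open>\<sigma> 0 = 0\<close> has no density and is treated
  apart.\<close>

lemma laplace_jump_time:
  assumes l: "0 < l"
  shows "(\<integral>\<^sup>+\<omega>. ennreal (exp (- l * \<sigma> n \<omega>)) \<partial>M) = ennreal ((rate / (l + rate)) ^ n)"
proof (cases n)
  case 0
  have "(\<integral>\<^sup>+\<omega>. ennreal (exp (- l * \<sigma> 0 \<omega>)) \<partial>M) = (\<integral>\<^sup>+\<omega>. 1 \<partial>M)"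
    by (intro nn_integral_cong) (simp add: jump_time_0)
  then show ?thesis
    using 0 by (simp add: emeasure_space_1)
next
  case (Suc k)
  have D: "distributed M lborel (\<sigma> (Suc k)) (erlang_density k rate)"
    using rate_pos by (intro erlang_distributedI measurable_jump_time emeasure_jump_time_le)
  have "(\<integral>\<^sup>+\<omega>. ennreal (exp (- l * \<sigma> (Suc k) \<omega>)) \<partial>M)
      = (\<integral>\<^sup>+t. ennreal (erlang_density k rate t) * ennreal (exp (- l * t)) \<partial>lborel)"
    by (rule distributed_nn_integral[OF D, symmetric]) simp
  also have "\<dots> = (\<integral>\<^sup>+t. ennreal ((rate / (l + rate)) ^ Suc k)
      * ennreal (erlang_density k (l + rate) t) \<partial>lborel)"
  proof (intro nn_integral_cong)
    fix t
    have "(rate / (l + rate)) ^ Suc k * (l + rate) ^ Suc k = rate ^ Suc k"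
      using rate_pos l by (simp flip: power_mult_distrib)
    then have "erlang_density k rate t * exp (- l * t)
        = (rate / (l + rate)) ^ Suc k * erlang_density k (l + rate) t"
      by (simp add: erlang_density_def mult_exp_exp ring_distribs mult.assoc del: power_Suc)
         (simp add: mult.assoc[symmetric] del: power_Suc)
    then show "ennreal (erlang_density k rate t) * ennreal (exp (- l * t))
      = ennreal ((rate / (l + rate)) ^ Suc k) * ennreal (erlang_density k (l + rate) t)"
      using rate_pos l by (simp flip: ennreal_mult del: power_Suc)
  qed
  also have "\<dots> = ennreal ((rate / (l + rate)) ^ Suc k)"
    \<comment> \<open>The moment of order 0 is the total mass of the density.\<close>
    using nn_integral_erlang_ith_moment[of "l + rate" k 0] rate_pos l
    by (simp add: nn_integral_cmult del: power_Suc)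
  finally show ?thesis
    using Suc by simp
qed

section \<open>Stopping times\<close>

lemma space_usual_filtration [simp]: "space (usual_filtration M N t) = space M"
  by (simp add: usual_filtration_def space_measure_of_conv)

lemma sets_null_augmented_filtration:
  "sets (null_augmented_filtration M N t) = sigma_sets (space M)
     ({N s -` A \<inter> space M | s A. 0 \<le> s \<and> ennreal s \<le> t} \<union> null_sets M)"
  unfolding null_augmented_filtration_def
  by (rule sets_measure_of) (auto dest: sets.sets_into_space)

lemma sets_null_augmented_filtration_subset: "sets (null_augmented_filtration M N t) \<subseteq> sets M"
  unfolding sets_null_augmented_filtration
  by (intro sets.sigma_sets_subset) (auto intro!: measurable_sets[OF measurable_N])

lemma sets_usual_filtration:
  "sets (usual_filtration M N t) =
     sigma_sets (space M) (\<Inter>u\<in>insert \<infinity> {t<..}. sets (null_augmented_filtration M N u))"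
  unfolding usual_filtration_def
  using sets_null_augmented_filtration_subset[of \<infinity>] sets.space_closed[of M]
  by (intro sets_measure_of) auto

lemma sets_usual_filtration_subset: "sets (usual_filtration M N t) \<subseteq> sets M"
  unfolding sets_usual_filtration
  using sets_null_augmented_filtration_subset[of \<infinity>]
  by (intro sets.sigma_sets_subset) auto

lemma measurable_stopping_time:
  assumes "\<tau> \<in> stopping_times M N"
  shows "\<tau> \<in> borel_measurable M"
proof (rule borel_measurableI_le)
  fix t
  have "{\<omega> \<in> space M. \<tau> \<omega> \<le> t} \<in> sets (usual_filtration M N t)"
    using assms unfolding stopping_times_def stopping_time_def pred_def by simp
  then show "{\<omega> \<in> space M. \<tau> \<omega> \<le> t} \<in> sets M"
    using sets_usual_filtration_subset by blast
qed

lemma zero_stopping_time: "(\<lambda>\<omega>. 0) \<in> stopping_times M N"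
  by (simp add: stopping_times_def stopping_time_def)

text \<open>The event that \<open>\<sigma> n\<close> is at most \<open>t\<close> is the event
  \<open>n \<le> N t\<close>, which lies in the augmented algebra of every \<open>u \<ge> t\<close>
  and hence in their intersection over \<open>u > t\<close>.\<close>

lemma min_jump_time_stopping_time:
  assumes "\<tau> \<in> stopping_times M N"
  shows "(\<lambda>\<omega>. min (\<tau> \<omega>) (ennreal (\<sigma> n \<omega>))) \<in> stopping_times M N"
  unfolding stopping_times_def stopping_time_def mem_Collect_eq min_le_iff_disj
proof (intro allI pred_intros_logic)
  fix t :: ennreal
  show "Measurable.pred (usual_filtration M N t) (\<lambda>\<omega>. \<tau> \<omega> \<le> t)"
    using assms by (simp add: stopping_times_def stopping_time_def)
  show "Measurable.pred (usual_filtration M N t) (\<lambda>\<omega>. ennreal (\<sigma> n \<omega>) \<le> t)"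
  proof (cases t)
    case (real s)
    have "{\<omega> \<in> space M. ennreal (\<sigma> n \<omega>) \<le> t} = N s -` {n..} \<inter> space M"
      using real jump_time_le_iff by auto
    moreover have "N s -` {n..} \<inter> space M \<in> sets (null_augmented_filtration M N u)" if "t \<le> u" for u
      unfolding sets_null_augmented_filtration using real that by (intro sigma_sets.Basic) auto
    ultimately show ?thesis
      unfolding pred_def sets_usual_filtration by auto
  qed simp
qed

end

section \<open>Costs along the process\<close>

text \<open>One starting point is fixed and the flow coefficients are abstracted. The sign
  conditions keep the quadrant invariant: those on \<open>b0\<close> and \<open>b1\<close> for the
  flows, \<open>1 \<le> \<mu>\<close> for the jump factor \<open>1 - 1 / \<mu>\<close>.\<close>

locale cost_process = poisson_process M \<mu> N for M :: "'a measure" and \<mu> N +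
  fixes lam c a0 b0 a1 b1 :: real and x y :: "real \<Rightarrow> real \<Rightarrow> real"
    and \<phi> :: "real \<times> real" and Z :: "real \<Rightarrow> 'a \<Rightarrow> real \<times> real"
  assumes lam_pos: "0 < lam" and mu_ge_1: "1 \<le> \<mu>" and c_pos: "0 < c"
    and b0_nonneg: "0 \<le> b0" and b1_nonneg: "0 \<le> b1"
    and x_ode: "\<And>u. solves_affine_ode a0 b0 u (\<lambda>t. x t u)"
    and y_ode: "\<And>u. solves_affine_ode a1 b1 u (\<lambda>t. y t u)"
    and \<phi>_nonneg: "\<phi> \<in> {0..} \<times> {0..}"
    and Z: "is_Phi_process M \<mu> N x y \<phi> Z"
begin

lemma Z_between_jumps:
  "\<omega> \<in> space M \<Longrightarrow> \<sigma> n \<omega> \<le> t \<Longrightarrow> t < \<sigma> (Suc n) \<omega> \<Longrightarrow>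
    Z t \<omega> = (x (t - \<sigma> n \<omega>) (fst (Z (\<sigma> n \<omega>) \<omega>)), y (t - \<sigma> n \<omega>) (snd (Z (\<sigma> n \<omega>) \<omega>)))"
  using Z unfolding is_Phi_process_def by blast

lemma Z_jump_time_0: "\<omega> \<in> space M \<Longrightarrow> Z (\<sigma> 0 \<omega>) \<omega> = \<phi>"
  using Z jump_time_0 unfolding is_Phi_process_def by metis

text \<open>Continuity of the flows identifies the left limit with the flow run over the whole
  waiting time. The resulting recursion without \<open>Lim\<close> drives the inductions for
  nonnegativity and measurability.\<close>

lemma Z_jump_time_Suc:
  assumes \<omega>: "\<omega> \<in> space M"
  shows "Z (\<sigma> (Suc n) \<omega>) \<omega> =
    ((1 - 1 / \<mu>) * x (\<sigma> (Suc n) \<omega> - \<sigma> n \<omega>) (fst (Z (\<sigma> n \<omega>) \<omega>)),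
     (1 + 1 / \<mu>) * y (\<sigma> (Suc n) \<omega> - \<sigma> n \<omega>) (snd (Z (\<sigma> n \<omega>) \<omega>)))"
proof -
  let ?s = "\<sigma> n \<omega>" and ?s' = "\<sigma> (Suc n) \<omega>"
  let ?f = "\<lambda>t. (x (t - ?s) (fst (Z ?s \<omega>)), y (t - ?s) (snd (Z ?s \<omega>)))"
  have "continuous_on UNIV (\<lambda>t. ?f t)"
    by (intro continuous_on_Pair
        continuous_on_compose2[OF affine_ode_continuous[OF x_ode, of UNIV]]
        continuous_on_compose2[OF affine_ode_continuous[OF y_ode, of UNIV]] continuous_intros) auto
  then have "(?f \<longlongrightarrow> ?f ?s') (at_left ?s')"
    by (meson UNIV_I continuous_on_def tendsto_within_subset subset_UNIV)
  moreover have "\<forall>\<^sub>F t in at_left ?s'. ?f t = Z t \<omega>"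
    using eventually_at_left_real[OF jump_time_less_Suc[OF \<omega>]]
    by eventually_elim (rule Z_between_jumps[OF \<omega>, symmetric], auto)
  ultimately have "((\<lambda>t. Z t \<omega>) \<longlongrightarrow> ?f ?s') (at_left ?s')"
    by (rule Lim_transform_eventually)
  then have "Lim (at_left ?s') (\<lambda>t. Z t \<omega>) = ?f ?s'"
    by (intro tendsto_Lim) auto
  moreover have "Z ?s' \<omega> = jump_map \<mu> (Lim (at_left ?s') (\<lambda>t. Z t \<omega>))"
    using Z \<omega> unfolding is_Phi_process_def by simp
  ultimately show ?thesis
    by (simp add: jump_map_def)
qed

lemma Z_jump_time_nonneg:
  assumes \<omega>: "\<omega> \<in> space M"
  shows "0 \<le> fst (Z (\<sigma> n \<omega>) \<omega>) \<and> 0 \<le> snd (Z (\<sigma> n \<omega>) \<omega>)"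
proof (induction n)
  case 0
  then show ?case
    using \<phi>_nonneg Z_jump_time_0[OF \<omega>] by auto
next
  case (Suc n)
  have "0 \<le> \<sigma> (Suc n) \<omega> - \<sigma> n \<omega>"
    using jump_time_less_Suc[OF \<omega>, of n] by simp
  then show ?case
    using Suc mu_ge_1 b0_nonneg b1_nonneg
    by (auto simp: Z_jump_time_Suc[OF \<omega>] intro!: mult_nonneg_nonneg
        affine_ode_nonneg[OF x_ode] affine_ode_nonneg[OF y_ode])
qed

lemma Z_nonneg:
  assumes \<omega>: "\<omega> \<in> space M" and "0 \<le> t"
  shows "0 \<le> fst (Z t \<omega>)" "0 \<le> snd (Z t \<omega>)"
  using jump_time_bracket[OF assms] Z_jump_time_nonneg[OF \<omega>] b0_nonneg b1_nonneg
  by (auto simp: Z_between_jumps[OF \<omega> jump_time_bracket[OF assms]]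
      intro!: affine_ode_nonneg[OF x_ode] affine_ode_nonneg[OF y_ode])

section \<open>Joint measurability of the flows and of the process\<close>

lemma measurable_x:
  assumes [measurable]: "f \<in> borel_measurable K" "g \<in> borel_measurable K"
  shows "(\<lambda>z. x (f z) (g z)) \<in> borel_measurable K"
proof -
  have [measurable]: "(\<lambda>t. x t 0) \<in> borel_measurable borel"
    by (intro borel_measurable_continuous_onI affine_ode_continuous[OF x_ode])
  have "x t u = exp (a0 * t) * u + x t 0" for t u
    by (rule affine_ode_eq[OF x_ode x_ode])
  then have "(\<lambda>z. x (f z) (g z)) = (\<lambda>z. exp (a0 * f z) * g z + x (f z) 0)"
    by (intro ext)
  then show ?thesis by simp
qed

lemma measurable_y:
  assumes [measurable]: "f \<in> borel_measurable K" "g \<in> borel_measurable K"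
  shows "(\<lambda>z. y (f z) (g z)) \<in> borel_measurable K"
proof -
  have [measurable]: "(\<lambda>t. y t 0) \<in> borel_measurable borel"
    by (intro borel_measurable_continuous_onI affine_ode_continuous[OF y_ode])
  have "y t u = exp (a1 * t) * u + y t 0" for t u
    by (rule affine_ode_eq[OF y_ode y_ode])
  then have "(\<lambda>z. y (f z) (g z)) = (\<lambda>z. exp (a1 * f z) * g z + y (f z) 0)"
    by (intro ext)
  then show ?thesis by simp
qed

lemma measurable_Z_jump_time:
  "(\<lambda>\<omega>. fst (Z (\<sigma> n \<omega>) \<omega>)) \<in> borel_measurable M \<and> (\<lambda>\<omega>. snd (Z (\<sigma> n \<omega>) \<omega>)) \<in> borel_measurable M"
proof (induction n)
  case 0
  then show ?case
    by (simp add: Z_jump_time_0 cong: measurable_cong)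
next
  case (Suc n)
  then have [measurable]: "(\<lambda>\<omega>. fst (Z (\<sigma> n \<omega>) \<omega>)) \<in> borel_measurable M"
    "(\<lambda>\<omega>. snd (Z (\<sigma> n \<omega>) \<omega>)) \<in> borel_measurable M"
    by auto
  note [measurable] = measurable_x measurable_y
  show ?case
    by (simp add: Z_jump_time_Suc cong: measurable_cong)
qed

text \<open>The value of \<open>Z\<close> at negative times is arbitrary, hence \<open>max 0\<close>.\<close>

lemma measurable_Z_pair:
  "(\<lambda>p. fst (Z (max 0 (snd p)) (fst p))) \<in> borel_measurable (M \<Otimes>\<^sub>M lborel)" (is ?fst)
  "(\<lambda>p. snd (Z (max 0 (snd p)) (fst p))) \<in> borel_measurable (M \<Otimes>\<^sub>M lborel)" (is ?snd)
proof -
  note [measurable] = measurable_x measurable_y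
    measurable_Z_jump_time[THEN conjunct1] measurable_Z_jump_time[THEN conjunct2]
  let ?t = "\<lambda>p :: 'a \<times> real. max 0 (snd p)"
  let ?r = "\<lambda>n p. ?t p - \<sigma> n (fst p)" and ?Z = "\<lambda>n p. Z (\<sigma> n (fst p)) (fst p)"
  have Z_eq: "Z (?t p) (fst p) = (x (?r n p) (fst (?Z n p)), y (?r n p) (snd (?Z n p)))"
    if "p \<in> space (M \<Otimes>\<^sub>M lborel)" "n = N (?t p) (fst p)" for n p
    using that by (auto simp: space_pair_measure intro!: Z_between_jumps jump_time_bracket)
  \<comment> \<open>For a fixed index the flow formula is measurable in the pair; the countably many
    formulas are glued along the measurable random index \<open>N\<close>.\<close>
  have "(\<lambda>p. x (?r (N (?t p) (fst p)) p) (fst (?Z (N (?t p) (fst p)) p)))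
      \<in> borel_measurable (M \<Otimes>\<^sub>M lborel)"
    by (rule measurable_compose_countable[OF _ measurable_N_pair]) measurable
  then show ?fst
    by (rule measurable_cong[THEN iffD1, rotated]) (simp add: Z_eq[OF _ refl])
  have "(\<lambda>p. y (?r (N (?t p) (fst p)) p) (snd (?Z (N (?t p) (fst p)) p)))
      \<in> borel_measurable (M \<Otimes>\<^sub>M lborel)"
    by (rule measurable_compose_countable[OF _ measurable_N_pair]) measurable
  then show ?snd
    by (rule measurable_cong[THEN iffD1, rotated]) (simp add: Z_eq[OF _ refl])
qed

section \<open>Pathwise cost: measurability, lower bound and effect of truncation\<close>

definition stopped_cost :: "('a \<Rightarrow> ennreal) \<Rightarrow> 'a \<Rightarrow> real \<Rightarrow> real" where
  "stopped_cost \<tau> \<omega> t = indicator {t. 0 \<le> t \<and> ennreal t \<le> \<tau> \<omega>} t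
     * (exp (- lam * t) * running_cost lam c (Z t \<omega>))"

definition pathwise_cost :: "('a \<Rightarrow> ennreal) \<Rightarrow> 'a \<Rightarrow> ereal" where
  "pathwise_cost \<tau> \<omega> = ext_integral lborel (\<lambda>t. ereal (stopped_cost \<tau> \<omega> t))"

lemma expected_cost_eq: "expected_cost M lam c Z \<tau> = ext_integral M (pathwise_cost \<tau>)"
  unfolding expected_cost_def pathwise_cost_def[abs_def] stopped_cost_def ..

lemma measurable_stopped_cost_pair:
  assumes [measurable]: "\<tau> \<in> borel_measurable M"
  shows "(\<lambda>p. stopped_cost \<tau> (fst p) (snd p)) \<in> borel_measurable (M \<Otimes>\<^sub>M lborel)"
proof -
  note [measurable] = measurable_Z_pair
  \<comment> \<open>The indicator vanishes at negative times, so \<open>max 0\<close> can be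
    inserted.\<close>
  have "(\<lambda>p. stopped_cost \<tau> (fst p) (snd p)) =
      (\<lambda>p. indicator {p. 0 \<le> snd p \<and> ennreal (snd p) \<le> \<tau> (fst p)} p
        * (exp (- lam * snd p) * running_cost lam c (Z (max 0 (snd p)) (fst p))))"
    by (auto simp: stopped_cost_def max_def split: split_indicator)
  also have "\<dots> \<in> borel_measurable (M \<Otimes>\<^sub>M lborel)"
    unfolding running_cost_def by measurable
  finally show ?thesis .
qed

lemma measurable_stopped_cost:
  assumes "\<tau> \<in> borel_measurable M" "\<omega> \<in> space M"
  shows "stopped_cost \<tau> \<omega> \<in> borel_measurable lborel"
  using measurable_compose[OF measurable_Pair1'[OF assms(2)] measurable_stopped_cost_pair[OF assms(1)]]
  by simp

lemma measurable_pathwise_cost: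
  assumes "\<tau> \<in> borel_measurable M"
  shows "pathwise_cost \<tau> \<in> borel_measurable M"
proof -
  note [measurable] = measurable_stopped_cost_pair[OF assms]
  show ?thesis
    unfolding pathwise_cost_def[abs_def] ext_integral_def by measurable
qed

text \<open>Nonnegativity of \<open>Z\<close> bounds the running cost below, and the bound survives
  stopping because it is nonpositive. The constants are grouped so that
  \<open>lam * exp (- lam * t)\<close> is a probability density on \<open>{0..}\<close>.\<close>

lemma stopped_cost_ge:
  assumes "\<omega> \<in> space M"
  shows "- (sqrt 2 / c * (lam * exp (- lam * t)) * indicator {0..} t) \<le> stopped_cost \<tau> \<omega> t"
proof (cases "0 \<le> t \<and> ennreal t \<le> \<tau> \<omega>")
  case True
  have "- (lam / c * sqrt 2) \<le> running_cost lam c (Z t \<omega>)"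
    unfolding running_cost_def using Z_nonneg[OF assms, of t] True by simp
  then have "exp (- lam * t) * - (lam / c * sqrt 2) \<le> exp (- lam * t) * running_cost lam c (Z t \<omega>)"
    by (rule mult_left_mono) simp
  then show ?thesis
    using True by (simp add: stopped_cost_def mult_ac)
next
  case False
  then show ?thesis
    using lam_pos c_pos by (auto simp: stopped_cost_def)
qed

text \<open>Taking \<open>s = 0\<close> bounds the negative part of every cost; taking
  \<open>s = \<sigma> n \<omega>\<close> bounds the loss by truncation.\<close>

lemma nn_integral_discount:
  "(\<integral>\<^sup>+t. ennreal (sqrt 2 / c * (lam * exp (- lam * t)) * indicator {s..} t) \<partial>lborel)
    = ennreal (sqrt 2 / c * exp (- lam * s))"
proof -
  have "(\<integral>\<^sup>+t. ennreal (sqrt 2 / c * (lam * exp (- lam * t)) * indicator {s..} t) \<partial>lborel)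
      = (\<integral>\<^sup>+t. ennreal (sqrt 2 / c) * (ennreal (lam * exp (- lam * t)) * indicator {s..} t) \<partial>lborel)"
    using lam_pos c_pos
    by (intro nn_integral_cong)
       (auto simp del: times_divide_eq_left simp flip: ennreal_mult split: split_indicator)
  also have "\<dots> = ennreal (sqrt 2 / c) * ennreal (exp (- lam * s))"
    using nn_integral_exp_atLeast[OF lam_pos, of s] by (subst nn_integral_cmult) simp_all
  also have "\<dots> = ennreal (sqrt 2 / c * exp (- lam * s))"
    using c_pos by (intro ennreal_mult[symmetric]) auto
  finally show ?thesis .
qed

lemma nn_integral_stopped_cost_neg:
  assumes "\<omega> \<in> space M"
  shows "(\<integral>\<^sup>+t. e2ennreal (- ereal (stopped_cost \<tau> \<omega> t)) \<partial>lborel) \<le> ennreal (sqrt 2 / c)"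
proof -
  have "(\<integral>\<^sup>+t. e2ennreal (- ereal (stopped_cost \<tau> \<omega> t)) \<partial>lborel)
      \<le> (\<integral>\<^sup>+t. ennreal (sqrt 2 / c * (lam * exp (- lam * t)) * indicator {0..} t) \<partial>lborel)"
    using stopped_cost_ge[OF assms, of _ \<tau>]
    by (intro nn_integral_mono) (auto intro!: ennreal_leI simp: minus_le_iff)
  then show ?thesis
    unfolding nn_integral_discount by simp
qed

lemma pathwise_cost_neg:
  assumes "\<omega> \<in> space M"
  shows "e2ennreal (- pathwise_cost \<tau> \<omega>) \<le> ennreal (sqrt 2 / c)"
proof -
  \<comment> \<open>The negative part of a difference of nonnegative quantities is at most the
    subtracted one; \<open>r < \<infinity>\<close> excludes infinity minus infinity.\<close>
  have *: "e2ennreal (- (enn2ereal p - enn2ereal q)) \<le> r" if "q \<le> r" "r < \<infinity>" for p q r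
    using that by (cases p; cases q; cases r) (auto simp: e2ennreal_neg intro!: ennreal_leI)
  show ?thesis
    unfolding pathwise_cost_def ext_integral_def
    by (rule *[OF nn_integral_stopped_cost_neg[OF assms]]) simp
qed

text \<open>The integrands differ only at times after \<open>\<sigma> n\<close> and up to
  \<open>\<tau>\<close>. There the truncated one is zero and the other at least minus the discounted
  bound, whose integral from \<open>\<sigma> n\<close> on is the added term.\<close>

lemma pathwise_cost_min_jump_time_le:
  assumes \<tau>: "\<tau> \<in> borel_measurable M" and \<omega>: "\<omega> \<in> space M"
  shows "pathwise_cost (\<lambda>\<omega>. min (\<tau> \<omega>) (ennreal (\<sigma> n \<omega>))) \<omega>
    \<le> pathwise_cost \<tau> \<omega> + ereal (sqrt 2 / c * exp (- lam * \<sigma> n \<omega>))"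
proof -
  let ?\<tau>' = "\<lambda>\<omega>. min (\<tau> \<omega>) (ennreal (\<sigma> n \<omega>))"
  let ?d = "\<lambda>t. sqrt 2 / c * (lam * exp (- lam * t)) * indicator {\<sigma> n \<omega>..} t"
  have \<tau>': "?\<tau>' \<in> borel_measurable M"
    using \<tau> by measurable
  have d: "0 \<le> ?d t" for t
    using lam_pos c_pos by simp
  have "stopped_cost ?\<tau>' \<omega> t \<le> stopped_cost \<tau> \<omega> t + ?d t" for t
  proof (cases "0 \<le> t \<and> ennreal t \<le> \<tau> \<omega> \<and> \<not> ennreal t \<le> ennreal (\<sigma> n \<omega>)")
    case True
    then have "\<sigma> n \<omega> \<le> t"
      using ennreal_leI by (meson linear)
    then show ?thesis
      using stopped_cost_ge[OF \<omega>, of t \<tau>] True by (simp add: stopped_cost_def)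
  next
    case False
    then have "stopped_cost ?\<tau>' \<omega> t = stopped_cost \<tau> \<omega> t"
      by (auto simp: stopped_cost_def split: split_indicator)
    then show ?thesis
      using d by simp
  qed
  then have "ext_integral lborel (\<lambda>t. ereal (stopped_cost ?\<tau>' \<omega> t))
      \<le> ext_integral lborel (\<lambda>t. ereal (stopped_cost \<tau> \<omega> t)) + enn2ereal (\<integral>\<^sup>+t. ennreal (?d t) \<partial>lborel)"
    using measurable_stopped_cost[OF \<tau> \<omega>] measurable_stopped_cost[OF \<tau>' \<omega>] d
    by (intro ext_integral_mono_add le_less_trans[OF nn_integral_stopped_cost_neg[OF \<omega>]])
       (simp_all only: nn_integral_discount, simp_all)
  then show ?thesis
    unfolding nn_integral_discount using c_pos
    by (simp add: pathwise_cost_def)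
qed

section \<open>Expected costs and value functions\<close>

text \<open>When the pathwise comparison is integrated, the Laplace transform of
  \<open>\<sigma> n\<close> at \<open>lam\<close> produces the geometric factor.\<close>

lemma expected_cost_min_jump_time_le:
  assumes \<tau>: "\<tau> \<in> borel_measurable M"
  shows "expected_cost M lam c Z (\<lambda>\<omega>. min (\<tau> \<omega>) (ennreal (\<sigma> n \<omega>)))
    \<le> expected_cost M lam c Z \<tau> + ereal (sqrt 2 / c * (\<mu> / (lam + \<mu>)) ^ n)"
proof -
  let ?d = "\<lambda>\<omega>. ennreal (sqrt 2 / c * exp (- lam * \<sigma> n \<omega>))"
  have \<tau>': "(\<lambda>\<omega>. min (\<tau> \<omega>) (ennreal (\<sigma> n \<omega>))) \<in> borel_measurable M"
    using \<tau> by measurable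
  have neg: "(\<integral>\<^sup>+\<omega>. e2ennreal (- pathwise_cost \<tau> \<omega>) \<partial>M) < \<infinity>" for \<tau>
  proof -
    have "(\<integral>\<^sup>+\<omega>. e2ennreal (- pathwise_cost \<tau> \<omega>) \<partial>M) \<le> (\<integral>\<^sup>+\<omega>. ennreal (sqrt 2 / c) \<partial>M)"
      by (intro nn_integral_mono pathwise_cost_neg)
    also have "\<dots> < \<infinity>"
      by (simp add: emeasure_space_1)
    finally show ?thesis .
  qed
  have "(\<integral>\<^sup>+\<omega>. ?d \<omega> \<partial>M) = ennreal (sqrt 2 / c) * (\<integral>\<^sup>+\<omega>. ennreal (exp (- lam * \<sigma> n \<omega>)) \<partial>M)"
    using c_pos by (subst nn_integral_cmult[symmetric]) (simp_all flip: ennreal_mult)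
  also have "\<dots> = ennreal (sqrt 2 / c * (\<mu> / (lam + \<mu>)) ^ n)"
    unfolding laplace_jump_time[OF lam_pos]
    using c_pos lam_pos rate_pos by (intro ennreal_mult[symmetric]) auto
  finally have d: "(\<integral>\<^sup>+\<omega>. ?d \<omega> \<partial>M) = ennreal (sqrt 2 / c * (\<mu> / (lam + \<mu>)) ^ n)" .
  have "ext_integral M (pathwise_cost (\<lambda>\<omega>. min (\<tau> \<omega>) (ennreal (\<sigma> n \<omega>))))
      \<le> ext_integral M (pathwise_cost \<tau>) + enn2ereal (\<integral>\<^sup>+\<omega>. ?d \<omega> \<partial>M)"
    using pathwise_cost_min_jump_time_le[OF \<tau>] c_pos
    by (intro ext_integral_mono_add measurable_pathwise_cost \<tau> \<tau>' neg)
       (simp_all only: d, simp_all)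
  then show ?thesis
    unfolding d using c_pos lam_pos rate_pos by (simp add: expected_cost_eq)
qed

lemma expected_cost_zero:
  assumes "\<And>\<omega>. \<omega> \<in> space M \<Longrightarrow> \<tau> \<omega> = 0"
  shows "expected_cost M lam c Z \<tau> = 0"
proof -
  have "pathwise_cost \<tau> \<omega> = 0" if "\<omega> \<in> space M" for \<omega>
  proof -
    \<comment> \<open>With \<open>\<tau> \<omega> = 0\<close> the indicator keeps only time 0, a
      Lebesgue null set.\<close>
    have "AE t in lborel. stopped_cost \<tau> \<omega> t = 0"
      using AE_lborel_singleton[of "0 :: real"]
      by eventually_elim (use assms[OF that] in \<open>auto simp: stopped_cost_def\<close>)
    then have "AE t in lborel. e2ennreal (ereal (stopped_cost \<tau> \<omega> t)) = 0"
      "AE t in lborel. e2ennreal (- ereal (stopped_cost \<tau> \<omega> t)) = 0"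
      by (auto elim: eventually_mono)
    then have "(\<integral>\<^sup>+t. e2ennreal (ereal (stopped_cost \<tau> \<omega> t)) \<partial>lborel) = (\<integral>\<^sup>+(t :: real). 0 \<partial>lborel)"
      "(\<integral>\<^sup>+t. e2ennreal (- ereal (stopped_cost \<tau> \<omega> t)) \<partial>lborel) = (\<integral>\<^sup>+(t :: real). 0 \<partial>lborel)"
      by - (rule nn_integral_cong_AE; assumption)+
    then show ?thesis
      by (simp add: pathwise_cost_def ext_integral_def)
  qed
  then have "(\<integral>\<^sup>+\<omega>. e2ennreal (pathwise_cost \<tau> \<omega>) \<partial>M) = (\<integral>\<^sup>+\<omega>. 0 \<partial>M)"
    "(\<integral>\<^sup>+\<omega>. e2ennreal (- pathwise_cost \<tau> \<omega>) \<partial>M) = (\<integral>\<^sup>+\<omega>. 0 \<partial>M)"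
    by (auto intro!: nn_integral_cong simp: e2ennreal_neg simp del: nn_integral_const)
  then show ?thesis
    by (simp add: expected_cost_eq ext_integral_def)
qed

text \<open>This is the truncation estimate at \<open>n = 0\<close>: since
  \<open>\<sigma> 0 = 0\<close>, the truncated cost vanishes.\<close>

lemma expected_cost_ge:
  assumes "\<tau> \<in> borel_measurable M"
  shows "- ereal (sqrt 2 / c) \<le> expected_cost M lam c Z \<tau>"
proof -
  have "expected_cost M lam c Z (\<lambda>\<omega>. min (\<tau> \<omega>) (ennreal (\<sigma> 0 \<omega>))) = 0"
    by (rule expected_cost_zero) (simp add: jump_time_0)
  then have "0 \<le> expected_cost M lam c Z \<tau> + ereal (sqrt 2 / c)"
    using expected_cost_min_jump_time_le[OF assms, of 0] by simp
  then show ?thesis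
    by (cases "expected_cost M lam c Z \<tau>") auto
qed

lemma value_bounds:
  defines "v \<equiv> INF \<tau>\<in>stopping_times M N. expected_cost M lam c Z \<tau>"
    and "w \<equiv> \<lambda>n. INF \<tau>\<in>stopping_times M N.
      expected_cost M lam c Z (\<lambda>\<omega>. min (\<tau> \<omega>) (ennreal (\<sigma> n \<omega>)))"
  shows "\<bar>v\<bar> \<noteq> \<infinity>" "v \<le> w n" "w n \<le> v + ereal (sqrt 2 / c * (\<mu> / (lam + \<mu>)) ^ n)"
proof -
  have "- ereal (sqrt 2 / c) \<le> v"
    unfolding v_def by (intro INF_greatest expected_cost_ge measurable_stopping_time)
  \<comment> \<open>Immediate stopping costs nothing.\<close>
  moreover have "v \<le> 0"
    unfolding v_def
    by (rule INF_lower2[OF zero_stopping_time]) (simp add: expected_cost_zero)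
  ultimately show "\<bar>v\<bar> \<noteq> \<infinity>"
    by (cases v) auto
  show "v \<le> w n"
    unfolding v_def w_def by (intro INF_greatest INF_lower min_jump_time_stopping_time)
  \<comment> \<open>Moving the real constant to the left leaves the bare infimum \<open>v\<close> on
    the right, so one \<open>\<tau>\<close> at a time can be treated.\<close>
  have "w n - ereal (sqrt 2 / c * (\<mu> / (lam + \<mu>)) ^ n) \<le> v"
    unfolding v_def
  proof (rule INF_greatest)
    fix \<tau> assume \<tau>: "\<tau> \<in> stopping_times M N"
    have "w n \<le> expected_cost M lam c Z (\<lambda>\<omega>. min (\<tau> \<omega>) (ennreal (\<sigma> n \<omega>)))"
      unfolding w_def using \<tau> by (rule INF_lower)
    also have "\<dots> \<le> expected_cost M lam c Z \<tau> + ereal (sqrt 2 / c * (\<mu> / (lam + \<mu>)) ^ n)"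
      by (rule expected_cost_min_jump_time_le[OF measurable_stopping_time[OF \<tau>]])
    finally show "w n - ereal (sqrt 2 / c * (\<mu> / (lam + \<mu>)) ^ n) \<le> expected_cost M lam c Z \<tau>"
      by (simp add: ereal_minus_le)
  qed
  then show "w n \<le> v + ereal (sqrt 2 / c * (\<mu> / (lam + \<mu>)) ^ n)"
    by (simp add: ereal_minus_le)
qed

end

section \<open>Uniform convergence of the truncated value functions\<close>

theorem proposition5p1:
  fixes M :: "'a measure"
    and N :: "real \<Rightarrow> 'a \<Rightarrow> nat"
    and x y :: "real \<Rightarrow> real \<Rightarrow> real"
    and \<Phi> :: "real \<times> real \<Rightarrow> real \<Rightarrow> 'a \<Rightarrow> real \<times> real"
    and lam \<mu> c m :: real
  assumes "0 < lam" and "1 < \<mu>" and "0 < c" and "-1 < m" and "m < 1"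
    and "poisson_process M \<mu> N"
    and "\<And>\<phi>\<^sub>0. solves_affine_ode (lam + 1) (lam * (1 - m) / sqrt 2) \<phi>\<^sub>0 (\<lambda>t. x t \<phi>\<^sub>0)"
    and "\<And>\<phi>\<^sub>1. solves_affine_ode (lam - 1) (lam * (1 + m) / sqrt 2) \<phi>\<^sub>1 (\<lambda>t. y t \<phi>\<^sub>1)"
    and "\<And>\<phi>. \<phi> \<in> {0..} \<times> {0..} \<Longrightarrow> is_Phi_process M \<mu> N x y \<phi> (\<Phi> \<phi>)"
  shows "uniform_limit ({0..} \<times> {0..})
           (\<lambda>n \<phi>. real_of_ereal (V_trunc M lam c N \<Phi> n \<phi>))
           (\<lambda>\<phi>. real_of_ereal (V M lam c N \<Phi> \<phi>)) sequentially
       \<and> (\<forall>n\<ge>1. \<forall>\<phi>\<in>{0..} \<times> {0..}.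
            ereal (sqrt 2 / c * (\<mu> / (lam + \<mu>)) ^ n) \<ge> V_trunc M lam c N \<Phi> n \<phi> - V M lam c N \<Phi> \<phi>
          \<and> V_trunc M lam c N \<Phi> n \<phi> - V M lam c N \<Phi> \<phi> \<ge> 0)"
proof -
  let ?w = "\<lambda>n \<phi>. V_trunc M lam c N \<Phi> n \<phi>" and ?v = "V M lam c N \<Phi>"
  let ?e = "\<lambda>n. sqrt 2 / c * (\<mu> / (lam + \<mu>)) ^ n"
  have bounds: "\<bar>?v \<phi>\<bar> \<noteq> \<infinity>" "?v \<phi> \<le> ?w n \<phi>" "?w n \<phi> \<le> ?v \<phi> + ereal (?e n)"
    if \<phi>: "\<phi> \<in> {0..} \<times> {0..}" for n \<phi>
  proof -
    interpret poisson_process M \<mu> N by fact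
    interpret cost_process M \<mu> N lam c "lam + 1" "lam * (1 - m) / sqrt 2"
        "lam - 1" "lam * (1 + m) / sqrt 2" x y \<phi> "\<Phi> \<phi>"
      using assms \<phi> by unfold_locales auto
    show "\<bar>?v \<phi>\<bar> \<noteq> \<infinity>" "?v \<phi> \<le> ?w n \<phi>" "?w n \<phi> \<le> ?v \<phi> + ereal (?e n)"
      unfolding V_def V_trunc_def by (rule value_bounds)+
  qed
  \<comment> \<open>Finiteness of \<open>V\<close> and the two bounds force \<open>V_trunc\<close>
    to be finite, so the extended and the real differences agree.\<close>
  have diff: "0 \<le> ?w n \<phi> - ?v \<phi>" "?w n \<phi> - ?v \<phi> \<le> ereal (?e n)"
    "\<bar>real_of_ereal (?w n \<phi>) - real_of_ereal (?v \<phi>)\<bar> \<le> ?e n"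
    if "\<phi> \<in> {0..} \<times> {0..}" for n \<phi>
    using bounds(1)[OF that] bounds(2,3)[OF that, of n] by (cases "?v \<phi>"; cases "?w n \<phi>"; simp)+
  have "(\<lambda>n. (\<mu> / (lam + \<mu>)) ^ n) \<longlonglongrightarrow> 0"
    using assms by (intro LIMSEQ_realpow_zero) auto
  then have e: "?e \<longlonglongrightarrow> 0"
    by (intro tendsto_mult_right_zero)
  \<comment> \<open>The bound \<open>?e n\<close> does not depend on \<open>\<phi>\<close>, so one
    threshold for \<open>n\<close> serves the whole quadrant.\<close>
  have "uniform_limit ({0..} \<times> {0..}) (\<lambda>n \<phi>. real_of_ereal (?w n \<phi>)) (\<lambda>\<phi>. real_of_ereal (?v \<phi>)) sequentially"
  proof (rule uniform_limitI)
    fix \<epsilon> :: real assume "0 < \<epsilon>"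
    with e have "\<forall>\<^sub>F n in sequentially. ?e n < \<epsilon>"
      by (rule order_tendstoD)
    then show "\<forall>\<^sub>F n in sequentially. \<forall>\<phi>\<in>{0..} \<times> {0..}.
        dist (real_of_ereal (?w n \<phi>)) (real_of_ereal (?v \<phi>)) < \<epsilon>"
      by eventually_elim (auto simp only: dist_real_def intro: le_less_trans[OF diff(3)])
  qed
  then show ?thesis
    using diff(1,2) by blast
qed

end
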